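(* Fix $N \ge 2$. Let $X, \overline{X} : [0,\infty) \to \mathbb{R}^N$ be two continuous functions with $X(0), \overline{X}(0) \in \mathcal{W}_N$ such that $$X(0) \le \overline{X}(0), \qquad X(t) - X(s) \le \overline{X}(t) - \overline{X}(s), \quad 0 \le s \le t.$$ Fix parameters of collision $(q^{\pm}_n)_{1 \le n \le N}$ and $(\overline{q}^{\pm}_n)_{1 \le n \le N}$ such that $q^+_n \le \overline{q}^+_n$ for $n = 2, \ldots, N$. Let $Y$ and $\overline{Y}$ be the systems of $N$ competing particles with driving functions $X$ and $\overline{X}$, and parameters of collision $(q^{\pm}_n)_{1 \le n \le N}$ and $(\overline{q}^{\pm}_n)_{1 \le n \le N}$, respectively. Then $$Y(t) \le \overline{Y}(t), \quad t \ge 0.$$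
   Context: Vectors are compared componentwise. $\mathcal{W}_N := \{y \in \mathbb{R}^N \mid y_1 \le \ldots \le y_N\}$. Parameters of collision for $N$ particles are real numbers $q^{+}_1, q^-_1, \ldots, q^{+}_N, q^-_N$ with $q^+_{k+1} + q^-_k = 1$ for $k = 1, \ldots, N-1$ and $0 < q^{\pm}_k < 1$ for $k = 1, \ldots, N$. System of competing particles: given a continuous $X = (X_1,\ldots,X_N)' : [0,\infty) \to \mathbb{R}^N$ with $X(0) \in \mathcal{W}_N$ and parameters of collision $(q_k^\pm)$, a system of $N$ competing particles with driving function $X$ and these parameters is a continuous function $Y = (Y_1,\ldots,Y_N)' : [0,\infty) \to \mathcal{W}_N$ together with continuous functions $L_{(1,2)}, \ldots, L_{(N-1,N)} : [0,\infty) \to \mathbb{R}$ such that, with $L_{(0,1)} \equiv 0$ and $L_{(N,N+1)} \equiv 0$: (i) $Y_k(t) = X_k(t) + q^+_k L_{(k-1,k)}(t) - q^-_k L_{(k,k+1)}(t)$ for $k = 1,\ldots,N$, $t \ge 0$; (ii) $L_{(k,k+1)}(0) = 0$; (iii) $L_{(k,k+1)}$ is nondecreasing; (iv) $L_{(k,k+1)}$ can increase only when $Y_k = Y_{k+1}$, i.e. $\int_0^\infty (Y_{k+1}(t) - Y_k(t))\,dL_{(k,k+1)}(t) = 0$, for $k=1,\ldots,N-1$. For given $X$ and parameters, this system exists and is unique. *)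

theory Defs
  imports "HOL-Analysis.Analysis"
begin

text \<open>A vector of \<open>\<real>\<^sup>N\<close> is a function on \<^typ>\<open>nat\<close> of which only the components
  \<open>1, \<dots>, N\<close> matter; a path is a function of time of which only the values on
  \<open>[0, \<infinity>)\<close> matter.\<close>

definition vec_le :: "nat \<Rightarrow> (nat \<Rightarrow> real) \<Rightarrow> (nat \<Rightarrow> real) \<Rightarrow> bool" where
  "vec_le N x y \<longleftrightarrow> (\<forall>k\<in>{1..N}. x k \<le> y k)"

definition weyl_chamber :: "nat \<Rightarrow> (nat \<Rightarrow> real) set" where
  "weyl_chamber N = {y. \<forall>k\<in>{1..<N}. y k \<le> y (k + 1)}"

definition continuous_path :: "nat \<Rightarrow> (real \<Rightarrow> nat \<Rightarrow> real) \<Rightarrow> bool" where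
  "continuous_path N X \<longleftrightarrow> (\<forall>k\<in>{1..N}. continuous_on {0..} (\<lambda>t. X t k))"

definition driving_function :: "nat \<Rightarrow> (real \<Rightarrow> nat \<Rightarrow> real) \<Rightarrow> bool" where
  "driving_function N X \<longleftrightarrow> continuous_path N X \<and> X 0 \<in> weyl_chamber N"

definition collision_params :: "nat \<Rightarrow> (nat \<Rightarrow> real) \<Rightarrow> (nat \<Rightarrow> real) \<Rightarrow> bool" where
  "collision_params N qp qm \<longleftrightarrow>
     (\<forall>k\<in>{1..<N}. qp (k + 1) + qm k = 1) \<and>
     (\<forall>k\<in>{1..N}. 0 < qp k \<and> qp k < 1 \<and> 0 < qm k \<and> qm k < 1)"

text \<open>The Stieltjes measure \<open>d\<ell>\<close> of a continuous nondecreasing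
  \<open>\<ell> : [0, \<infinity>) \<rightarrow> \<real>\<close>. The function is extended to the negative axis by the constant
  \<open>\<ell> 0\<close>, because \<^const>\<open>interval_measure\<close> needs monotonicity and right-continuity on
  the whole real line; so \<open>(-\<infinity>, 0]\<close> carries no mass.\<close>

definition stieltjes_measure :: "(real \<Rightarrow> real) \<Rightarrow> real measure" where
  "stieltjes_measure l = interval_measure (\<lambda>t. l (max 0 t))"

text \<open>\<open>L k\<close> stands for \<open>L\<^bsub>(k,k+1)\<^esub>\<close>, \<open>k = 0, \<dots>, N\<close>.
  The integral in the last clause is the nonnegative one, whose value may be \<open>\<infinity>\<close>:
  the integrand is nonnegative since \<open>Y t\<close> lies in the chamber, and the Bochner integral
  would also be \<open>0\<close> for a non-integrable integrand.\<close>

definition competing_system ::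
  "nat \<Rightarrow> (real \<Rightarrow> nat \<Rightarrow> real) \<Rightarrow> (nat \<Rightarrow> real) \<Rightarrow> (nat \<Rightarrow> real) \<Rightarrow>
   (real \<Rightarrow> nat \<Rightarrow> real) \<Rightarrow> (nat \<Rightarrow> real \<Rightarrow> real) \<Rightarrow> bool" where
  "competing_system N X qp qm Y L \<longleftrightarrow>
     continuous_path N Y \<and> (\<forall>t\<ge>0. Y t \<in> weyl_chamber N) \<and>
     (\<forall>t\<ge>0. L 0 t = 0 \<and> L N t = 0) \<and>
     (\<forall>k\<in>{1..N}. \<forall>t\<ge>0. Y t k = X t k + qp k * L (k - 1) t - qm k * L k t) \<and>
     (\<forall>k\<in>{1..<N}.
        continuous_on {0..} (L k) \<and>
        L k 0 = 0 \<and>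
        mono_on {0..} (L k) \<and>
        (\<integral>\<^sup>+t\<in>{0..}. ennreal (Y t (k + 1) - Y t k) \<partial>stieltjes_measure (L k)) = 0)"

end

theory Submission
  imports Defs
begin

text \<open>Shifting all components of \<open>X'\<close> and \<open>Y'\<close> by \<open>\<epsilon> > 0\<close> preserves the system, so one may
  assume \<open>X 0 < X' 0\<close>. Let \<open>t\<close> be the first time at which \<open>Y\<close> touches \<open>Y'\<close>, and \<open>k\<close> the least
  index with \<open>Y t k = Y' t k\<close>. Then \<open>Y t (k - 1) < Y t k\<close>, so \<open>L (k - 1)\<close> is constant just
  before \<open>t\<close>. Since \<open>Y l - Y' l\<close> increases over \<open>[s, t]\<close> whenever the particles \<open>l\<close> touch at \<open>t\<close>,
  induction on \<open>l \<ge> k\<close> shows that the increments satisfy \<open>qm l * \<Delta>L l < qm' l * \<Delta>L' l\<close>: this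
  forces \<open>\<Delta>L' l > 0\<close>, hence \<open>Y' t l = Y' t (l + 1)\<close>, so the particles \<open>l + 1\<close> touch as well, and
  the ordering of the parameters carries the inequality over to \<open>l + 1\<close>. At \<open>l = N\<close> it reads
  \<open>0 < 0\<close>.\<close>

lemma emeasure_stieltjes_measure_Ioc:
  assumes "mono_on {0..} l" "continuous_on {0..} l" "0 \<le> s" "s \<le> t"
  shows "emeasure (stieltjes_measure l) {s<..t} = ennreal (l t - l s)"
proof -
  have cont: "continuous_on UNIV (\<lambda>t. l (max 0 t))"
    by (rule continuous_on_compose2[OF assms(2)]) (auto intro!: continuous_intros)
  have "emeasure (interval_measure (\<lambda>t. l (max 0 t))) {s<..t} = l (max 0 t) - l (max 0 s)"
  proof (rule emeasure_interval_measure_Ioc)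
    show "l (max 0 x) \<le> l (max 0 y)" if "x \<le> y" for x y
      using that by (intro mono_onD[OF assms(1)]) auto
    show "continuous (at_right a) (\<lambda>t. l (max 0 t))" for a
      using cont by (simp add: continuous_on_eq_continuous_at continuous_at_imp_continuous_at_within)
  qed (use assms in auto)
  with assms show ?thesis
    by (simp add: stieltjes_measure_def max_def)
qed

text \<open>On the compact interval from \<open>s\<close> to \<open>t\<close> the function
  \<open>g\<close> has a positive minimum \<open>g x\<close>, so the vanishing integral is at least
  \<open>g x * (l t - l s)\<close>.\<close>

lemma constant_where_integrand_positive:
  fixes g l :: "real \<Rightarrow> real"
  assumes l: "mono_on {0..} l" "continuous_on {0..} l"
    and zero: "(\<integral>\<^sup>+t\<in>{0..}. ennreal (g t) \<partial>stieltjes_measure l) = 0"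
    and g: "continuous_on {0..} g" "\<And>x. s \<le> x \<Longrightarrow> x \<le> t \<Longrightarrow> 0 < g x"
    and st: "0 \<le> s" "s \<le> t"
  shows "l s = l t"
proof -
  have "continuous_on {s..t} g"
    using g(1) by (rule continuous_on_subset) (use st in auto)
  then obtain x where x: "x \<in> {s..t}" "\<And>y. y \<in> {s..t} \<Longrightarrow> g x \<le> g y"
    using continuous_attains_inf[of "{s..t}" g] st by auto
  have "ennreal (g x) * emeasure (stieltjes_measure l) {s<..t}
      = (\<integral>\<^sup>+y. ennreal (g x) * indicator {s<..t} y \<partial>stieltjes_measure l)"
    by (rule nn_integral_cmult_indicator[symmetric]) (simp add: stieltjes_measure_def)
  also have "\<dots> \<le> (\<integral>\<^sup>+y\<in>{0..}. ennreal (g y) \<partial>stieltjes_measure l)"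
    by (rule nn_integral_mono) (use x(2) st in \<open>auto simp: indicator_def intro!: ennreal_leI\<close>)
  finally have "ennreal (g x) * ennreal (l t - l s) = 0"
    using zero emeasure_stieltjes_measure_Ioc[OF l st] by simp
  moreover have "0 < g x"
    using g(2) x(1) by simp
  ultimately have "l t \<le> l s"
    by (auto simp: ennreal_eq_0_iff)
  moreover have "l s \<le> l t"
    using mono_onD[OF l(1)] st by simp
  ultimately show ?thesis by simp
qed

text \<open>The times at which some \<open>f k\<close> is nonnegative form a finite union of closed
  sets, so their infimum is itself such a time.\<close>

lemma first_zero:
  fixes f :: "'a \<Rightarrow> real \<Rightarrow> real"
  assumes fin: "finite K"
    and cont: "\<And>k. k \<in> K \<Longrightarrow> continuous_on {0..} (f k)"
    and neg: "\<And>k. k \<in> K \<Longrightarrow> f k 0 < 0"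
    and ex: "k0 \<in> K" "0 \<le> u" "0 \<le> f k0 u"
  obtains t where "0 < t" "\<exists>k\<in>K. f k t = 0" "\<And>k. k \<in> K \<Longrightarrow> f k t \<le> 0"
    "\<And>k s. k \<in> K \<Longrightarrow> 0 \<le> s \<Longrightarrow> s < t \<Longrightarrow> f k s < 0"
proof -
  define S where "S = (\<Union>k\<in>K. {0..} \<inter> f k -` {0..})"
  define t where "t = Inf S"
  have S_iff: "x \<in> S \<longleftrightarrow> 0 \<le> x \<and> (\<exists>k\<in>K. 0 \<le> f k x)" for x
    by (auto simp: S_def)
  have "closed S"
    unfolding S_def using fin cont by (intro closed_UN ballI continuous_closed_preimage) auto
  moreover have bdd: "bdd_below S"
    by (auto simp: bdd_below_def S_iff)
  moreover have "u \<in> S"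
    using ex by (auto simp: S_iff)
  ultimately have "t \<in> S"
    unfolding t_def by (metis closed_contains_Inf empty_iff)
  then obtain k where k: "k \<in> K" "0 \<le> f k t" and t0: "0 \<le> t"
    by (auto simp: S_iff)
  have before: "f j s < 0" if "j \<in> K" "0 \<le> s" "s < t" for j s
  proof (rule ccontr)
    assume "\<not> f j s < 0"
    with that have "s \<in> S"
      by (force simp: S_iff not_less)
    from cInf_lower[OF this bdd] that show False
      by (simp add: t_def)
  qed
  \<comment> \<open>A positive value at \<open>t\<close> would, by the intermediate value theorem,
    force a zero strictly before \<open>t\<close>.\<close>
  have at: "f j t \<le> 0" if j: "j \<in> K" for j
  proof (rule ccontr)
    assume pos: "\<not> f j t \<le> 0"
    have "continuous_on {0..t} (f j)"
      using cont[OF j] by (rule continuous_on_subset) auto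
    then obtain x where "0 \<le> x" "x \<le> t" "f j x = 0"
      using IVT'[of "f j" 0 0 t] neg[OF j] pos t0 by auto
    with before[OF j, of x] pos show False
      by (cases "x = t") auto
  qed
  have "t \<noteq> 0"
    using neg[OF k(1)] k(2) by auto
  with t0 have "0 < t" by simp
  moreover have "\<exists>k\<in>K. f k t = 0"
    using at[OF k(1)] k by force
  ultimately show thesis
    using that at before by blast
qed

text \<open>By continuity the gap stays positive on a short interval ending at \<open>t\<close>, and
  there the complementarity integral leaves \<open>L k\<close> no mass.\<close>

lemma collision_term_constant_while_apart:
  assumes sys: "competing_system N X qp qm Y L"
    and k: "k \<in> {1..<N}" and t: "0 < t" and apart: "Y t k < Y t (k + 1)"
  obtains s0 where "0 \<le> s0" "s0 < t" "\<And>s. s0 \<le> s \<Longrightarrow> s \<le> t \<Longrightarrow> L k s = L k t"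
proof -
  let ?g = "\<lambda>t. Y t (k + 1) - Y t k"
  have g: "continuous_on {0..} ?g"
    using sys k by (auto simp: competing_system_def continuous_path_def intro!: continuous_on_diff)
  have "isCont ?g t"
    by (rule continuous_on_interior[OF g]) (use t in simp)
  then have "eventually (\<lambda>x. 0 < ?g x) (at t)"
    using apart by (intro order_tendstoD(1)[of ?g "?g t"]) (auto simp: isCont_def)
  then obtain d where d: "d > 0" "\<And>x. x \<noteq> t \<Longrightarrow> dist x t < d \<Longrightarrow> 0 < ?g x"
    by (auto simp: eventually_at)
  \<comment> \<open>The maximum keeps the interval inside the time domain; halving \<open>d\<close>
    makes the distance to \<open>t\<close> strictly less than \<open>d\<close>.\<close>
  define s0 where "s0 = max 0 (t - d / 2)"
  have s0: "0 \<le> s0" "s0 < t" "t - s0 < d"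
    using d(1) t by (auto simp: s0_def)
  have pos: "0 < ?g x" if "s0 \<le> x" "x \<le> t" for x
    using that d(2)[of x] apart s0 by (cases "x = t") (auto simp: dist_real_def)
  have "L k s = L k t" if "s0 \<le> s" "s \<le> t" for s
    by (rule constant_where_integrand_positive[of _ ?g])
       (use sys k g pos that s0 in \<open>auto simp: competing_system_def\<close>)
  with s0 that show thesis by blast
qed

lemma competing_system_shift:
  assumes "competing_system N X qp qm Y L"
  shows "competing_system N (\<lambda>t k. X t k + c) qp qm (\<lambda>t k. Y t k + c) L"
  using assms unfolding competing_system_def continuous_path_def weyl_chamber_def
  by (auto intro!: continuous_on_add continuous_on_const)

lemma competing_system_at_0:
  assumes "competing_system N X qp qm Y L" "k \<in> {1..N}"
  shows "Y 0 k = X 0 k"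
proof -
  have "L j 0 = 0" if "j \<le> N" for j
    using assms(1) that by (cases "j = 0 \<or> j = N") (auto simp: competing_system_def)
  moreover have "Y 0 k = X 0 k + qp k * L (k - 1) 0 - qm k * L k 0"
    using assms by (auto simp: competing_system_def)
  moreover have "k - 1 \<le> N" "k \<le> N"
    using assms(2) by auto
  ultimately show ?thesis
    by simp
qed

text \<open>The boundary indices \<open>0\<close> and \<open>N\<close> are included, where
  \<open>L k\<close> vanishes, so that particles \<open>1\<close> and \<open>N\<close> can be
  treated like the others.\<close>

lemma collision_term_mono:
  assumes "competing_system N X qp qm Y L" "k \<le> N" "0 \<le> s" "s \<le> t"
  shows "L k s \<le> L k t"
  using assms
  by (cases "k = 0 \<or> k = N") (auto simp: competing_system_def intro: mono_onD[of "{0..}" "L k"])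

lemma competing_system_strict_comparison:
  assumes X0: "\<And>k. k \<in> {1..N} \<Longrightarrow> X 0 k < X' 0 k"
    and incr: "\<And>k s t. k \<in> {1..N} \<Longrightarrow> 0 \<le> s \<Longrightarrow> s \<le> t \<Longrightarrow> X t k - X s k \<le> X' t k - X' s k"
    and q: "collision_params N qp qm" and q': "collision_params N qp' qm'"
    and qq: "\<And>n. n \<in> {2..N} \<Longrightarrow> qp n \<le> qp' n"
    and sys: "competing_system N X qp qm Y L"
    and sys': "competing_system N X' qp' qm' Y' L'"
    and u: "0 \<le> u" and k0: "k0 \<in> {1..N}"
  shows "Y u k0 < Y' u k0"
proof (rule ccontr)
  assume "\<not> Y u k0 < Y' u k0"
  define D where "D k t = Y t k - Y' t k" for k t
  obtain t where t: "0 < t" and ex: "\<exists>k\<in>{1..N}. D k t = 0"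
    and at: "\<And>k. k \<in> {1..N} \<Longrightarrow> D k t \<le> 0"
    and before: "\<And>k s. k \<in> {1..N} \<Longrightarrow> 0 \<le> s \<Longrightarrow> s < t \<Longrightarrow> D k s < 0"
  proof (rule first_zero[of "{1..N}" D k0 u])
    show "continuous_on {0..} (D k)" if "k \<in> {1..N}" for k
      using that sys sys' unfolding D_def
      by (auto simp: competing_system_def continuous_path_def intro!: continuous_on_diff)
    show "D k 0 < 0" if "k \<in> {1..N}" for k
      using X0[OF that] competing_system_at_0[OF sys that] competing_system_at_0[OF sys' that]
      by (simp add: D_def)
    show "0 \<le> D k0 u"
      using \<open>\<not> Y u k0 < Y' u k0\<close> by (simp add: D_def)
  qed (use k0 u in auto)
  have chamber: "Y t k \<le> Y t (k + 1)" "Y' t k \<le> Y' t (k + 1)" if "k \<in> {1..<N}" for k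
    using that sys sys' t by (auto simp: competing_system_def weyl_chamber_def)

  define k where "k = (LEAST k. k \<in> {1..N} \<and> D k t = 0)"
  have k: "k \<in> {1..N}" "D k t = 0"
    using LeastI_ex[of "\<lambda>k. k \<in> {1..N} \<and> D k t = 0"] ex unfolding k_def by blast+
  have k_least: "D j t < 0" if "j \<in> {1..N}" "j < k" for j
    using not_less_Least[of j "\<lambda>k. k \<in> {1..N} \<and> D k t = 0"] that at[of j] by (auto simp: k_def)

  obtain s0 where s0: "0 \<le> s0" "s0 < t"
    and s0_const: "\<And>s. s0 \<le> s \<Longrightarrow> s \<le> t \<Longrightarrow> L (k - 1) s = L (k - 1) t"
  proof (cases "k = 1")
    case True
    then show thesis
      using that[of 0] sys t by (simp add: competing_system_def)
  next
    case False
    with k have k1: "k - 1 \<in> {1..<N}" "k - 1 + 1 = k" by auto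
    \<comment> \<open>Minimality of \<open>k\<close> gives
      \<open>Y t (k - 1) < Y' t (k - 1)\<close>, and the latter is at most
      \<open>Y' t k = Y t k\<close>.\<close>
    have "Y t (k - 1) < Y t k"
      using k_least[of "k - 1"] chamber(2)[OF k1(1)] k(2) k1 by (simp add: D_def)
    then show thesis
      using collision_term_constant_while_apart[OF sys k1(1) t] k1(2) that by metis
  qed

  \<comment> \<open>\<open>D j\<close> rises from a negative value to \<open>0\<close> over the
    interval from \<open>s\<close> to \<open>t\<close>, while the driving functions contribute a
    nonpositive amount to this rise. The collision terms must therefore supply a strictly positive
    one.\<close>
  have push: "0 < qp j * (L (j - 1) t - L (j - 1) s) - qm j * (L j t - L j s)
      - qp' j * (L' (j - 1) t - L' (j - 1) s) + qm' j * (L' j t - L' j s)"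
    if "j \<in> {1..N}" "D j t = 0" "0 \<le> s" "s < t" for j s
  proof -
    have "Y r j = X r j + qp j * L (j - 1) r - qm j * L j r"
      "Y' r j = X' r j + qp' j * L' (j - 1) r - qm' j * L' j r" if "0 \<le> r" for r
      using sys sys' \<open>j \<in> {1..N}\<close> that by (auto simp: competing_system_def)
    from this[of s] this[of t] show ?thesis
      using before[of j s] incr[of j s t] that by (simp add: D_def algebra_simps)
  qed

  \<comment> \<open>The inequality is carried for every \<open>s\<close> from \<open>s0\<close> up
    to \<open>t\<close>, because the induction step evaluates it at times arbitrarily close to
    \<open>t\<close>.\<close>
  have touch: "D l t = 0 \<and>
      (\<forall>s. s0 \<le> s \<and> s < t \<longrightarrow> qm l * (L l t - L l s) < qm' l * (L' l t - L' l s))"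
    if "k \<le> l" "l \<le> N" for l
    using that
  proof (induction l rule: dec_induct)
    case base
    have "qm k * (L k t - L k s) < qm' k * (L' k t - L' k s)" if s: "s0 \<le> s" "s < t" for s
    proof -
      have "0 \<le> qp' k * (L' (k - 1) t - L' (k - 1) s)"
        using q' k(1) s s0 collision_term_mono[OF sys', of "k - 1" s t]
        by (intro mult_nonneg_nonneg) (auto simp: collision_params_def less_imp_le)
      with push[OF k, of s] s0_const[of s] s s0 show ?thesis by simp
    qed
    with k show ?case by blast
  next
    case (step l)
    then have l: "l \<in> {1..<N}" and l1: "l + 1 \<in> {1..N}"
      and D: "D l t = 0"
      and less: "\<And>s. s0 \<le> s \<Longrightarrow> s < t \<Longrightarrow> qm l * (L l t - L l s) < qm' l * (L' l t - L' l s)"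
      using k(1) by auto
    have pos: "0 < qm l" "0 < qm' l" "0 < qp (l + 1)"
      using q q' l l1 by (auto simp: collision_params_def)
    have qp_le: "qp (l + 1) \<le> qp' (l + 1)"
      using qq[of "l + 1"] l by auto
    have qm_le: "qm' l \<le> qm l"
      using qp_le q q' l by (force simp: collision_params_def)
    \<comment> \<open>Otherwise \<open>L' l\<close> is constant from some \<open>s1\<close> on, and
      at \<open>max s0 s1\<close> the strict inequality puts a nonnegative number below
      \<open>0\<close>.\<close>
    have "Y' t l = Y' t (l + 1)"
    proof (rule ccontr)
      assume "Y' t l \<noteq> Y' t (l + 1)"
      with chamber(2)[OF l] have "Y' t l < Y' t (l + 1)" by simp
      from collision_term_constant_while_apart[OF sys' l t this] obtain s1
        where s1: "0 \<le> s1" "s1 < t" "\<And>s. s1 \<le> s \<Longrightarrow> s \<le> t \<Longrightarrow> L' l s = L' l t"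
        by blast
      have "0 \<le> qm l * (L l t - L l (max s0 s1))"
        using pos l s0 s1 collision_term_mono[OF sys, of l "max s0 s1" t] by simp
      with less[of "max s0 s1"] s1(3)[of "max s0 s1"] s0 s1(2) show False by simp
    qed
    \<comment> \<open>Here \<open>Y' t (l + 1) = Y' t l = Y t l\<close>, which is at most
      \<open>Y t (l + 1)\<close>; the reverse bound is \<open>at\<close>.\<close>
    then have D1: "D (l + 1) t = 0"
      using D chamber(1)[OF l] at[OF l1] by (simp add: D_def)
    have "qm (l + 1) * (L (l + 1) t - L (l + 1) s) < qm' (l + 1) * (L' (l + 1) t - L' (l + 1) s)"
      if s: "s0 \<le> s" "s < t" for s
    proof -
      have a': "0 \<le> L' l t - L' l s"
        using collision_term_mono[OF sys', of l s t] l s s0 by simp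
      \<comment> \<open>Replacing \<open>qm' l\<close> by the larger \<open>qm l\<close> allows
        cancellation, so the increments of \<open>L l\<close> and \<open>L' l\<close> are compared
        directly. Then \<open>qp (l + 1) \<le> qp' (l + 1)\<close> bounds the upward push on
        particle \<open>l + 1\<close>.\<close>
      have "qm l * (L l t - L l s) \<le> qm l * (L' l t - L' l s)"
        using less[OF s] mult_right_mono[OF qm_le a'] by simp
      then have "L l t - L l s \<le> L' l t - L' l s"
        using pos(1) by simp
      then have "qp (l + 1) * (L l t - L l s) \<le> qp (l + 1) * (L' l t - L' l s)"
        using pos(3) by simp
      also have "\<dots> \<le> qp' (l + 1) * (L' l t - L' l s)"
        using qp_le a' by (rule mult_right_mono)
      finally show ?thesis
        using push[OF l1 D1, of s] s s0 by simp
    qed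
    with D1 show ?case by simp
  qed
  have "L N r = 0" "L' N r = 0" if "0 \<le> r" for r
    using sys sys' that by (auto simp: competing_system_def)
  with touch[of N] k(1) s0 t show False by force
qed

theorem theorem3p2:
  fixes N :: nat
    and X X' Y Y' :: "real \<Rightarrow> nat \<Rightarrow> real"
    and qp qm qp' qm' :: "nat \<Rightarrow> real"
    and L L' :: "nat \<Rightarrow> real \<Rightarrow> real"
  assumes "N \<ge> 2"
    and "driving_function N X" and "driving_function N X'"
    and "vec_le N (X 0) (X' 0)"
    and "\<And>s t. 0 \<le> s \<Longrightarrow> s \<le> t \<Longrightarrow>
           vec_le N (\<lambda>k. X t k - X s k) (\<lambda>k. X' t k - X' s k)"
    and "collision_params N qp qm" and "collision_params N qp' qm'"
    and "\<And>n. n \<in> {2..N} \<Longrightarrow> qp n \<le> qp' n"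
    and "competing_system N X qp qm Y L"
    and "competing_system N X' qp' qm' Y' L'"
  shows "\<forall>t\<ge>0. vec_le N (Y t) (Y' t)"
  unfolding vec_le_def
\<comment> \<open>The strict comparison is applied to the shifted system for each \<epsilon>, and
  the weak inequality follows since \<epsilon> is arbitrary.\<close>
proof (intro allI impI ballI, rule field_le_epsilon)
  fix t \<epsilon> :: real and k
  assume t: "0 \<le> t" and k: "k \<in> {1..N}" and \<epsilon>: "0 < \<epsilon>"
  show "Y t k \<le> Y' t k + \<epsilon>"
  proof (rule less_imp_le, rule competing_system_strict_comparison[where Y' = "\<lambda>t k. Y' t k + \<epsilon>",
        OF _ _ assms(6-9) competing_system_shift[OF assms(10)] t k])
    show "X 0 j < X' 0 j + \<epsilon>" if "j \<in> {1..N}" for j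
      using assms(4) that \<epsilon> by (force simp: vec_le_def)
    show "X r j - X s j \<le> X' r j + \<epsilon> - (X' s j + \<epsilon>)" if "j \<in> {1..N}" "0 \<le> s" "s \<le> r" for j s r
      using assms(5)[OF that(2,3)] that(1) by (simp add: vec_le_def)
  qed
qed

end
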